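(* Let $\ell\ge1$ and $0\le a\le\ell$. There is a bijection $\Phi:\mathscr{T}_{(\ell-a,a)}\to\mathrm{DHK}_{a,\ell}$ from the set of tight cylindric partitions of profile $(\ell-a,a)$ to the set $\mathrm{DHK}_{a,\ell}$ of colored partitions which takes the maximum part of a tight cylindric partition to the number of (non-zero) parts of the corresponding colored partition, i.e., $\#(\Phi(\pi))=\max(\pi)$ for every $\pi\in\mathscr{T}_{(\ell-a,a)}$.
   Context: A partition is a weakly decreasing finite sequence of positive integers (its parts), extended by zeros beyond its last part. For $(c_1,c_2)\in\mathbb{Z}_{\ge0}^2$, a cylindric partition of profile $(c_1,c_2)$ is a pair of (possibly empty) partitions $\pi=(\pi^{(1)},\pi^{(2)})$ such that $\pi^{(1)}_j\ge\pi^{(2)}_{j+c_2}$ and $\pi^{(2)}_j\ge\pi^{(1)}_{j+c_1}$ for all $j\ge1$. It is tight if for every positive integer $j$ at least one of $\pi^{(1)},\pi^{(2)}$ does not contain $j$ as a part; $\mathscr{T}_{(c_1,c_2)}$ denotes the set of tight cylindric partitions of profile $(c_1,c_2)$. $\max(\pi)$ is the largest part occurring in $\pi$ ($0$ if both rows are empty). $\mathrm{DHK}_{a,\ell}$ (Dousse--Hardiman--Konan partitions) is the set of finite sequences of colored parts $\lambda_1\ge\lambda_2\ge\cdots\ge\lambda_s=0$ ($s\ge1$), where the $\lambda_i$ are non-negative integers and each part $\lambda_i$ carries a color $u_i\in\{0,1,\dots,\ell\}$, such that: (1) $\lambda_i-\lambda_{i+1}=|u_i-u_{i+1}|$ for all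 $1\le i\le s-1$; (2) the color of $\lambda_s=0$ is $u_s=a$; (3) there is exactly one part of size $0$. The number of parts, not counting the final $0$, is $\#(\lambda)=s-1$. *)

theory Defs
  imports Main
begin

definition is_partition :: "nat list \<Rightarrow> bool" where
  "is_partition p \<longleftrightarrow> sorted_wrt (\<ge>) p \<and> (\<forall>x\<in>set p. 0 < x)"

text \<open>Parts are indexed from 1 and extended by zeros; index 0 is never used.\<close>

definition part :: "nat list \<Rightarrow> nat \<Rightarrow> nat" where
  "part p j = (if 1 \<le> j \<and> j \<le> length p then p ! (j - 1) else 0)"

definition cylindric_partitions :: "nat \<Rightarrow> nat \<Rightarrow> (nat list \<times> nat list) set" where
  "cylindric_partitions c1 c2 =
     {(p1, p2). is_partition p1 \<and> is_partition p2 \<and>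
        (\<forall>j\<ge>1. part p1 j \<ge> part p2 (j + c2)) \<and>
        (\<forall>j\<ge>1. part p2 j \<ge> part p1 (j + c1))}"

definition tight :: "nat list \<times> nat list \<Rightarrow> bool" where
  "tight \<pi> \<longleftrightarrow> (\<forall>j>0. j \<notin> set (fst \<pi>) \<or> j \<notin> set (snd \<pi>))"

definition tight_cylindric_partitions :: "nat \<Rightarrow> nat \<Rightarrow> (nat list \<times> nat list) set" where
  "tight_cylindric_partitions c1 c2 = {\<pi> \<in> cylindric_partitions c1 c2. tight \<pi>}"

definition max_part :: "nat list \<times> nat list \<Rightarrow> nat" where
  "max_part \<pi> = Max (insert 0 (set (fst \<pi>) \<union> set (snd \<pi>)))"

text \<open>A colored part is a pair of its size and its color; the list lists the parts
  from first to last, so its last entry is the final part 0.\<close>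

type_synonym colored_part = "nat \<times> nat"

abbreviation part_size :: "colored_part \<Rightarrow> nat" where
  "part_size \<equiv> fst"

abbreviation part_color :: "colored_part \<Rightarrow> nat" where
  "part_color \<equiv> snd"

definition DHK :: "nat \<Rightarrow> nat \<Rightarrow> colored_part list set" where
  "DHK a l =
     {xs. xs \<noteq> [] \<and>
        sorted_wrt (\<ge>) (map part_size xs) \<and>
        part_size (last xs) = 0 \<and>
        (\<forall>x\<in>set xs. part_color x \<le> l) \<and>
        (\<forall>i. Suc i < length xs \<longrightarrow>
           int (part_size (xs ! i)) - int (part_size (xs ! Suc i))
             = \<bar>int (part_color (xs ! i)) - int (part_color (xs ! Suc i))\<bar>) \<and>
        part_color (last xs) = a \<and>
        card {i. i < length xs \<and> part_size (xs ! i) = 0} = 1}"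

definition num_parts :: "colored_part list \<Rightarrow> nat" where
  "num_parts xs = length xs - 1"

end

(* A partition p is determined by the numbers x_v of its parts that are at least v (v \<ge> 1).
   For a pair of partitions with such numbers x_v and y_v, being cylindric of profile (l - a, a)
   means -a \<le> x_v - y_v \<le> l - a, and being tight means that x_v and y_v do not both
   drop from v to v + 1.  Hence v \<mapsto> x_v + a - y_v is a sequence of colors in {0..l}
   ending in a, and x_v + y_v is the sequence of sizes, because by tightness its steps are the
   absolute values of the color steps.  The sequence first reaches size 0 right after the maximal
   part. *)
theory Submission
  imports Defs
begin

section \<open>Conjugate partitions: for a partition \<open>p\<close> and v at least 1,
  \<open>num_ge p v\<close> is part v of the conjugate of \<open>p\<close>\<close>

definition num_ge :: "nat list \<Rightarrow> nat \<Rightarrow> nat" where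
  "num_ge p v = length (filter ((\<le>) v) p)"

lemma num_ge_simps [simp]:
  "num_ge [] v = 0"
  "num_ge (x # p) v = (if v \<le> x then Suc (num_ge p v) else num_ge p v)"
  "num_ge (p @ q) v = num_ge p v + num_ge q v"
  "num_ge (replicate k x) v = (if v \<le> x then k else 0)"
  by (simp_all add: num_ge_def)

lemma num_ge_eq_0_iff: "num_ge p v = 0 \<longleftrightarrow> (\<forall>x\<in>set p. x < v)"
  by (induction p) auto

lemma num_ge_eq_count_add: "num_ge p v = count_list p v + num_ge p (Suc v)"
  by (induction p) auto

lemma num_ge_Suc_eq_iff: "num_ge p v = num_ge p (Suc v) \<longleftrightarrow> v \<notin> set p"
  using num_ge_eq_count_add[of p v] by (simp add: count_list_0_iff)

lemma num_ge_Suc_le: "num_ge p (Suc v) \<le> num_ge p v"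
  using num_ge_eq_count_add[of p v] by simp

text \<open>As the parts weakly decrease, those of size at least v occupy an initial segment of the
  indices. Taking v positive keeps the padding zeros out of the comparison.\<close>

lemma le_part_iff:
  assumes "is_partition p" "1 \<le> j" "1 \<le> v"
  shows "v \<le> part p j \<longleftrightarrow> j \<le> num_ge p v"
  using assms
proof (induction p arbitrary: j)
  case Nil
  then show ?case by (auto simp: part_def)
next
  case (Cons x p)
  have p: "is_partition p" and le: "\<forall>y\<in>set p. y \<le> x"
    using Cons.prems by (auto simp: is_partition_def)
  show ?case
  proof (cases "j = 1")
    case True
    have "num_ge p v = 0" if "x < v"
      using le that by (auto simp: num_ge_eq_0_iff)
    then show ?thesis
      using True by (auto simp: part_def)
  next
    case False
    then obtain k where k: "j = Suc k" "1 \<le> k"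
      using Cons.prems by (cases j) auto
    have part: "part (x # p) j = part p k"
      using k by (auto simp: part_def nth_Cons split: nat.split)
    have "num_ge p v = 0" if "x < v"
      using le that by (auto simp: num_ge_eq_0_iff)
    then show ?thesis
      using Cons.IH[OF p k(2)] Cons.prems part k by auto
  qed
qed

lemma num_ge_1: "is_partition p \<Longrightarrow> num_ge p (Suc 0) = length p"
  by (simp add: num_ge_def is_partition_def Suc_le_eq)

lemma partition_eqI:
  assumes p: "is_partition p" and q: "is_partition q"
    and eq: "\<And>i. num_ge p (Suc i) = num_ge q (Suc i)"
  shows "p = q"
proof (rule nth_equalityI)
  show len: "length p = length q"
    using eq[of 0] p q by (simp add: num_ge_1)
  fix i
  assume i: "i < length p"
  have "Suc k \<le> part p (Suc i) \<longleftrightarrow> Suc k \<le> part q (Suc i)" for k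
    using p q eq[of k] by (simp add: le_part_iff)
  then have "part p (Suc i) = part q (Suc i)"
    by (metis Suc_le_eq linorder_neq_iff)
  then show "p ! i = q ! i"
    using i len by (simp add: part_def)
qed

text \<open>Every weakly decreasing, eventually zero sequence is a conjugate: this is where the
  partitions needed for surjectivity come from.\<close>

lemma ex_partition_num_ge:
  fixes f :: "nat \<Rightarrow> nat"
  assumes "\<And>i. f (Suc i) \<le> f i" and "\<And>i. n \<le> i \<Longrightarrow> f i = 0"
  shows "\<exists>p. is_partition p \<and> (\<forall>i. num_ge p (Suc i) = f i)"
  using assms
proof (induction n arbitrary: f)
  case 0
  then show ?case by (intro exI[of _ "[]"]) (simp add: is_partition_def)
next
  case (Suc n)
  have anti: "f j \<le> f i" if "i \<le> j" for i j
    using Suc.prems(1) that by (rule lift_Suc_antimono_le)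
  \<comment> \<open>The value \<open>f n\<close> is the number of parts equal to
    \<open>Suc n\<close>. Removing these lowers the counts at indices up to \<open>n\<close> by
    \<open>f n\<close> and leaves a sequence that vanishes from \<open>n\<close> on.\<close>
  define g where "g i = f i - f n" for i
  have "g (Suc i) \<le> g i" for i
    unfolding g_def by (intro diff_le_mono Suc.prems(1))
  moreover have "g i = 0" if "n \<le> i" for i
    using anti[OF that] by (simp add: g_def)
  ultimately have "\<exists>p. is_partition p \<and> (\<forall>i. num_ge p (Suc i) = g i)"
    by (rule Suc.IH)
  then obtain p where p: "is_partition p" "\<And>i. num_ge p (Suc i) = g i"
    by blast
  have "num_ge p (Suc n) = 0"
    using p(2) by (simp add: g_def)
  then have le: "\<forall>x\<in>set p. x \<le> n"
    by (auto simp: num_ge_eq_0_iff less_Suc_eq_le)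
  let ?q = "replicate (f n) (Suc n) @ p"
  have "is_partition ?q"
    using p(1) le sorted_wrt_iff_nth_less[of "(\<ge>)" "replicate (f n) (Suc n)"]
    by (auto simp: is_partition_def sorted_wrt_append le_SucI)
  moreover have "num_ge ?q (Suc i) = f i" for i
    using p(2)[of i] anti[of i n] anti[of n i] Suc.prems(2)[of i]
    by (cases "i \<le> n") (auto simp: g_def)
  ultimately show ?case by blast
qed

section \<open>Tight cylindric pairs in terms of conjugates: a shift of indices becomes an additive
  bound\<close>

lemma part_shift_le_iff:
  assumes "is_partition p" "is_partition q"
  shows "(\<forall>j\<ge>1. part q (j + c) \<le> part p j) \<longleftrightarrow>
         (\<forall>i. num_ge q (Suc i) \<le> num_ge p (Suc i) + c)"
proof (intro iffI allI impI)
  fix i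
  assume le: "\<forall>j\<ge>1. part q (j + c) \<le> part p j"
  show "num_ge q (Suc i) \<le> num_ge p (Suc i) + c"
  proof (rule ccontr)
    \<comment> \<open>This is the first index at which the part of \<open>p\<close> falls below
      \<open>Suc i\<close>, while the negated bound keeps the part of \<open>q\<close> at
      \<open>?j + c\<close> at or above \<open>Suc i\<close>.\<close>
    let ?j = "num_ge p (Suc i) + 1"
    assume "\<not> ?thesis"
    then have "Suc i \<le> part q (?j + c)"
      using assms(2) by (subst le_part_iff) auto
    also have "\<dots> \<le> part p ?j"
      using le[rule_format, of ?j] by simp
    finally show False
      using assms(1) by (subst (asm) le_part_iff) auto
  qed
next
  fix j :: nat
  assume le: "\<forall>i. num_ge q (Suc i) \<le> num_ge p (Suc i) + c" and j: "1 \<le> j"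
  show "part q (j + c) \<le> part p j"
  \<comment> \<open>A nonzero value of this part itself serves as the threshold
    \<open>Suc i\<close>.\<close>
  proof (cases "part q (j + c)")
    case (Suc i)
    then have "j + c \<le> num_ge q (Suc i)"
      using assms(2) j by (subst le_part_iff[symmetric]) auto
    then have "j \<le> num_ge p (Suc i)"
      using le[rule_format, of i] by linarith
    then have "Suc i \<le> part p j"
      using assms(1) j by (subst le_part_iff) auto
    then show ?thesis
      using Suc by simp
  qed simp
qed

lemma tight_cylindric_iff:
  "(p, q) \<in> tight_cylindric_partitions c1 c2 \<longleftrightarrow>
     is_partition p \<and> is_partition q \<and>
     (\<forall>i. num_ge q (Suc i) \<le> num_ge p (Suc i) + c2) \<and>
     (\<forall>i. num_ge p (Suc i) \<le> num_ge q (Suc i) + c1) \<and>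
     (\<forall>i. num_ge p (Suc i) = num_ge p (Suc (Suc i)) \<or> num_ge q (Suc i) = num_ge q (Suc (Suc i)))"
proof -
  have "tight (p, q) \<longleftrightarrow> (\<forall>i. Suc i \<notin> set p \<or> Suc i \<notin> set q)"
    unfolding tight_def by (metis fst_conv snd_conv gr0_conv_Suc zero_less_Suc)
  then show ?thesis
    using part_shift_le_iff[of p q c2] part_shift_le_iff[of q p c1]
    unfolding tight_cylindric_partitions_def cylindric_partitions_def num_ge_Suc_eq_iff by blast
qed

section \<open>The largest part and the map to colored partitions\<close>

lemma max_part_less_iff:
  "max_part (p, q) < Suc i \<longleftrightarrow> num_ge p (Suc i) = 0 \<and> num_ge q (Suc i) = 0"
  unfolding max_part_def num_ge_eq_0_iff by (subst Max_less_iff) auto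

text \<open>List position \<open>i\<close> records threshold \<open>Suc i\<close>. The list reaches
  one threshold past the maximum, where both counts vanish and the entry is \<open>(0, a)\<close>.
  On cylindric pairs of profile \<open>(l - a, a)\<close> the truncated subtraction is exact,
  because the second count exceeds the first by at most \<open>a\<close>.\<close>

definition dhk_of :: "nat \<Rightarrow> nat list \<times> nat list \<Rightarrow> colored_part list" where
  "dhk_of a \<pi> =
     map (\<lambda>i. (num_ge (fst \<pi>) (Suc i) + num_ge (snd \<pi>) (Suc i),
               num_ge (fst \<pi>) (Suc i) + a - num_ge (snd \<pi>) (Suc i)))
         [0..<Suc (max_part \<pi>)]"

lemma length_dhk_of [simp]: "length (dhk_of a \<pi>) = Suc (max_part \<pi>)"
  by (simp add: dhk_of_def)

lemma nth_dhk_of: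
  "i \<le> max_part (p, q) \<Longrightarrow>
     dhk_of a (p, q) ! i =
       (num_ge p (Suc i) + num_ge q (Suc i), num_ge p (Suc i) + a - num_ge q (Suc i))"
  unfolding dhk_of_def by (subst nth_map) (simp_all del: upt_Suc)

lemma dhk_of_in_DHK:
  assumes "(p, q) \<in> tight_cylindric_partitions (l - a) a" "a \<le> l"
  shows "dhk_of a (p, q) \<in> DHK a l"
proof -
  let ?n = "max_part (p, q)" and ?xs = "dhk_of a (p, q)"
  let ?x = "\<lambda>i. num_ge p (Suc i)" and ?y = "\<lambda>i. num_ge q (Suc i)"
  have yx: "?y i \<le> ?x i + a" and xy: "?x i \<le> ?y i + (l - a)"
    and tight: "?x i = ?x (Suc i) \<or> ?y i = ?y (Suc i)" for i
    using assms(1) by (auto simp: tight_cylindric_iff)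
  have nonempty: "?xs \<noteq> []"
    by (metis length_dhk_of list.size(3) nat.distinct(1))
  have last: "last ?xs = (0, a)"
    using nonempty nth_dhk_of[of ?n p q a] max_part_less_iff[of p q ?n] by (simp add: last_conv_nth)
  have zero_iff: "part_size (?xs ! i) = 0 \<longleftrightarrow> i = ?n" if "i < length ?xs" for i
    using that nth_dhk_of[of i p q a] max_part_less_iff[of p q i] by auto
  have "sorted_wrt (\<ge>) (map part_size ?xs)"
  proof -
    have "?x j + ?y j \<le> ?x i + ?y i" if "i < j" for i j
      using lift_Suc_antimono_le[of "\<lambda>i. ?x i + ?y i" i j] that
      by (simp add: num_ge_Suc_le add_mono)
    then show ?thesis
      by (simp add: sorted_wrt_iff_nth_less nth_dhk_of)
  qed
  moreover have "\<forall>c\<in>set ?xs. part_color c \<le> l"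
  proof -
    have "?x i + a - ?y i \<le> l" for i
      using xy[of i] assms(2) by linarith
    then show ?thesis
      by (auto simp: in_set_conv_nth nth_dhk_of)
  qed
  \<comment> \<open>By tightness at most one count changes. A drop in the first lowers size and
    color equally; a drop in the second lowers the size and raises the color equally.\<close>
  moreover have "int (part_size (?xs ! i)) - int (part_size (?xs ! Suc i))
             = \<bar>int (part_color (?xs ! i)) - int (part_color (?xs ! Suc i))\<bar>"
    if "Suc i < length ?xs" for i
    using that tight[of i] yx[of i] yx[of "Suc i"] num_ge_Suc_le[of p "Suc i"] num_ge_Suc_le[of q "Suc i"]
    by (auto simp: nth_dhk_of of_nat_diff)
  moreover have "{i. i < length ?xs \<and> part_size (?xs ! i) = 0} = {?n}"
    using zero_iff by auto
  ultimately show ?thesis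
    using nonempty last by (simp add: DHK_def)
qed

section \<open>Bijectivity of the map\<close>

lemma inj_on_dhk_of: "inj_on (dhk_of a) (tight_cylindric_partitions (l - a) a)"
proof (rule inj_onI, clarify)
  fix p q p' q'
  assume T: "(p, q) \<in> tight_cylindric_partitions (l - a) a"
    and T': "(p', q') \<in> tight_cylindric_partitions (l - a) a"
    and eq: "dhk_of a (p, q) = dhk_of a (p', q')"
  have max: "max_part (p, q) = max_part (p', q')"
    using eq by (metis length_dhk_of nat.inject)
  \<comment> \<open>Up to the common maximum, equal sums and equal differences force equal counts;
    beyond it all four counts are zero.\<close>
  have "num_ge p (Suc i) = num_ge p' (Suc i) \<and> num_ge q (Suc i) = num_ge q' (Suc i)" for i
  proof (cases "i \<le> max_part (p, q)")
    case True
    have "num_ge q (Suc i) \<le> num_ge p (Suc i) + a" "num_ge q' (Suc i) \<le> num_ge p' (Suc i) + a"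
      using T T' unfolding tight_cylindric_iff by blast+
    then show ?thesis
      using nth_dhk_of[of i p q a] nth_dhk_of[of i p' q' a] True unfolding eq max
      by simp linarith
  next
    case False
    then show ?thesis
      using max max_part_less_iff[of p q i] max_part_less_iff[of p' q' i] by simp
  qed
  moreover have "is_partition p" "is_partition q" "is_partition p'" "is_partition q'"
    using T T' unfolding tight_cylindric_iff by blast+
  ultimately show "p = p' \<and> q = q'"
    using partition_eqI by blast
qed

text \<open>The two conjugates are recovered from the colors alone: from each position to the end,
  one collects the total descent of the colors and the other the total ascent.\<close>

lemma DHK_in_range:
  assumes xs: "xs \<in> DHK a l" and "a \<le> l"
  obtains \<pi> where "\<pi> \<in> tight_cylindric_partitions (l - a) a" "dhk_of a \<pi> = xs"
proof -
  have nonempty: "xs \<noteq> []" and size_last: "part_size (last xs) = 0" and color_last: "part_color (last xs) = a"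
    and color_le: "\<forall>c\<in>set xs. part_color c \<le> l"
    and steps: "\<And>i. Suc i < length xs \<Longrightarrow>
      int (part_size (xs ! i)) - int (part_size (xs ! Suc i))
        = \<bar>int (part_color (xs ! i)) - int (part_color (xs ! Suc i))\<bar>"
    and one_zero: "card {i. i < length xs \<and> part_size (xs ! i) = 0} = 1"
    using xs unfolding DHK_def by blast+
  define n where "n = length xs - 1"
  \<comment> \<open>Continuing with the final color \<open>a\<close> makes all later color steps
    zero, so the recurrences for \<open>x\<close> and \<open>y\<close> hold at every index.\<close>
  define u where "u i = (if i < n then part_color (xs ! i) else a)" for i
  have len: "length xs = Suc n" and last: "xs ! n = (0, a)"
    using nonempty size_last color_last by (simp_all add: n_def last_conv_nth prod_eq_iff)
  have color: "part_color (xs ! i) = u i" if "i \<le> n" for i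
    using that last by (auto simp: u_def)
  have u_le: "u i \<le> l" for i
    using color_le len assms(2) by (simp add: u_def)
  have size_step: "int (part_size (xs ! i)) = int (part_size (xs ! Suc i)) + \<bar>int (u i) - int (u (Suc i))\<bar>"
    if "i < n" for i
    using steps[of i] color[of i] color[of "Suc i"] len that by simp
  have pos: "part_size (xs ! i) > 0" if "i < n" for i
  proof (rule ccontr)
    assume "\<not> ?thesis"
    then have "{i, n} \<subseteq> {i. i < length xs \<and> part_size (xs ! i) = 0}"
      using that len last by auto
    then have "card {i, n} \<le> card {i. i < length xs \<and> part_size (xs ! i) = 0}"
      by (intro card_mono) auto
    then show False
      using one_zero that by simp
  qed
  \<comment> \<open>Truncated subtraction selects the descents here and the ascents in
    \<open>y\<close>.\<close>
  define x where "x i = (\<Sum>k = i..<n. u k - u (Suc k))" for i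
  define y where "y i = (\<Sum>k = i..<n. u (Suc k) - u k)" for i
  have x_step: "x i = (u i - u (Suc i)) + x (Suc i)" and y_step: "y i = (u (Suc i) - u i) + y (Suc i)" for i
    by (cases "i < n"; simp add: x_def y_def u_def sum.atLeast_Suc_lessThan)+
  have x0: "x i = 0" and y0: "y i = 0" if "n \<le> i" for i
    using that by (simp_all add: x_def y_def)
  \<comment> \<open>Descents minus ascents telescope to \<open>u i - a\<close>; in
    \<open>size_eq\<close> below, descents plus ascents add up the absolute color steps.\<close>
  have color_eq: "u i + y i = x i + a" for i
  proof (cases "i \<le> n")
    case True
    then show ?thesis
    proof (induction rule: inc_induct)
      case base
      then show ?case by (simp add: x0 y0 u_def)
    next
      case (step i)
      then show ?case using x_step[of i] y_step[of i] by linarith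
    qed
  qed (simp add: x0 y0 u_def)
  have size_eq: "part_size (xs ! i) = x i + y i" if "i \<le> n" for i
    using that
  proof (induction rule: inc_induct)
    case base
    then show ?case by (simp add: x0 y0 last)
  next
    case (step i)
    then show ?case using size_step[of i] x_step[of i] y_step[of i] by linarith
  qed
  obtain p where p: "is_partition p" "\<And>i. num_ge p (Suc i) = x i"
    using ex_partition_num_ge[of x n] x_step x0 by (metis le_add2)
  obtain q where q: "is_partition q" "\<And>i. num_ge q (Suc i) = y i"
    using ex_partition_num_ge[of y n] y_step y0 by (metis le_add2)
  have "y i \<le> x i + a" "x i \<le> y i + (l - a)" for i
    using color_eq[of i] u_le[of i] assms(2) by linarith+
  \<comment> \<open>A color step cannot be both a descent and an ascent; this yields
    tightness.\<close>
  moreover have "x i = x (Suc i) \<or> y i = y (Suc i)" for i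
    using x_step[of i] y_step[of i] by linarith
  ultimately have T: "(p, q) \<in> tight_cylindric_partitions (l - a) a"
    using p q by (simp add: tight_cylindric_iff)
  \<comment> \<open>Uniqueness of the zero part enters here: through \<open>pos\<close>,
    \<open>x\<close> and \<open>y\<close> cannot both vanish before \<open>n\<close>, so the maximum
    is exactly \<open>n\<close>.\<close>
  have max_less: "max_part (p, q) < Suc i \<longleftrightarrow> n \<le> i" for i
    using max_part_less_iff[of p q i] p(2)[of i] q(2)[of i] pos[of i] size_eq[of i] x0[of i] y0[of i]
    by (cases "n \<le> i") auto
  have max: "max_part (p, q) = n"
    using max_less[of n] max_less[of "max_part (p, q)"] by simp
  have "dhk_of a (p, q) = xs"
  proof (rule nth_equalityI)
    fix i
    assume "i < length (dhk_of a (p, q))"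
    then have i: "i \<le> n"
      by (simp add: max)
    then show "dhk_of a (p, q) ! i = xs ! i"
      using size_eq[of i] color[of i] color_eq[of i] p(2) q(2)
      by (simp add: nth_dhk_of max prod_eq_iff)
  qed (simp add: max len)
  with T show thesis
    by (rule that)
qed

theorem mainTheorem3:
  fixes l a :: nat
  assumes "1 \<le> l" and "a \<le> l"
  shows "\<exists>\<Phi> :: nat list \<times> nat list \<Rightarrow> colored_part list.
           bij_betw \<Phi> (tight_cylindric_partitions (l - a) a) (DHK a l) \<and>
           (\<forall>\<pi>\<in>tight_cylindric_partitions (l - a) a. num_parts (\<Phi> \<pi>) = max_part \<pi>)"
proof (intro exI conjI)
  have "dhk_of a ` tight_cylindric_partitions (l - a) a = DHK a l"
  proof
    show "dhk_of a ` tight_cylindric_partitions (l - a) a \<subseteq> DHK a l"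
      using dhk_of_in_DHK assms(2) by auto
    show "DHK a l \<subseteq> dhk_of a ` tight_cylindric_partitions (l - a) a"
      using DHK_in_range assms(2) by (metis image_eqI subsetI)
  qed
  then show "bij_betw (dhk_of a) (tight_cylindric_partitions (l - a) a) (DHK a l)"
    by (simp add: bij_betw_def inj_on_dhk_of)
  show "\<forall>\<pi>\<in>tight_cylindric_partitions (l - a) a. num_parts (dhk_of a \<pi>) = max_part \<pi>"
    by (simp add: num_parts_def)
qed

end
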